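(* Let $D_1,D_2$ be $(2^n,2^n,2^n,1)$-relative difference sets in $\mathbb{Z}_4^n$ relative to $2\mathbb{Z}_4^n$ whose $\mathbb{F}_2^n$-representations $h_1,h_2:\mathbb{F}_2^n\to\mathbb{F}_2^n$ are normalized. Let $M:\mathbb{F}_2^n\to\mathbb{F}_2^n$ be an invertible $\mathbb{F}_2$-linear map. Then there exists a matrix $L\in M_{n\times n}(\mathbb{Z}/4\mathbb{Z})$ whose reduction modulo $2$ is the matrix of $M$ (i.e. $(L\bmod 2)x^T=M(x)$ for all $x$) such that $D_2=\rho(L)(D_1)$, if and only if $$M(x)*_{h_2}M(y)=M(x*_{h_1}y)\quad\text{for all }x,y\in\mathbb{F}_2^n.$$
   Context: A $k$-subset $D$ of a group $G$ of order $mn$ with subgroup $N$ of order $n$ is an $(m,n,k,\lambda)$-relative difference set relative to $N$ if every element of $G\setminus N$ is represented exactly $\lambda$ times as a difference of elements of $D$ and no nonzero element of $N$ is. Let $\psi:\mathbb{F}_2\to\mathbb{Z}_4$ be $0\mapsto0$, $1\mapsto1$, $\Psi$ its coordinatewise extension $\mathbb{F}_2^n\to\mathbb{Z}_4^n$, and write $\lfloor a,b\rfloor:=\Psi(a)+2\Psi(b)$ ($a,b\in\mathbb{F}_2^n$); every element of $\mathbb{Z}_4^n$ has a unique such form. Such a relative difference set $D$ is a transversal of $2\mathbb{Z}_4^n$, so its elements are uniquely $\lfloor d,h(d)\rfloor$ for a map $h:\mathbb{F}_2^n\to\mathbb{F}_2^n$ (the $\mathbb{F}_2^n$-representation of $D$);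 $h$ is normalized if no coordinate function of $h$ (written as a reduced polynomial in $x_0,\dots,x_{n-1}$ over $\mathbb{F}_2$) has a linear or constant term. For $x,y\in\mathbb{F}_2^n$, $x\odot y=(x_0y_0,\dots,x_{n-1}y_{n-1})$ and $x*_hy:=h(x+y)+h(x)+h(y)+x\odot y$. For $L\in M_{n\times n}(\mathbb{Z}/4\mathbb{Z})$, $\rho(L)$ is the endomorphism $v\mapsto Lv^T$ of $\mathbb{Z}_4^n$. *)

theory Defs
  imports "HOL-Analysis.Analysis" "HOL-Library.Z2" "HOL-Library.Numeral_Type"
begin

text \<open>
  The field with two elements is \<^typ>\<open>bit\<close>, the ring of integers modulo 4 is the numeral type
  \<^typ>\<open>4\<close>, and \<^typ>\<open>'n\<close> is an arbitrary finite index type with \<open>n = CARD('n)\<close> elements.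
  Tuples are indexed by \<^typ>\<open>'n\<close> instead of by \<open>0, \<dots>, n - 1\<close>.
\<close>

definition is_subgroup :: "'a::group_add set \<Rightarrow> bool" where
  "is_subgroup N \<longleftrightarrow> 0 \<in> N \<and> (\<forall>x\<in>N. \<forall>y\<in>N. x + y \<in> N) \<and> (\<forall>x\<in>N. - x \<in> N)"

text \<open>The ambient group is the whole type.\<close>

definition relative_difference_set ::
    "nat \<Rightarrow> nat \<Rightarrow> nat \<Rightarrow> nat \<Rightarrow> 'a::{finite, group_add} set \<Rightarrow> 'a set \<Rightarrow> bool" where
  "relative_difference_set m n k l N D \<longleftrightarrow>
     CARD('a) = m * n \<and> is_subgroup N \<and> card N = n \<and> card D = k \<and>
     (\<forall>g. g \<notin> N \<longrightarrow> card {(x, y). x \<in> D \<and> y \<in> D \<and> x - y = g} = l) \<and>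
     (\<forall>g\<in>N. g \<noteq> 0 \<longrightarrow> \<not> (\<exists>x\<in>D. \<exists>y\<in>D. x - y = g))"

definition twice_Z4 :: "(4 ^ 'n) set" where
  "twice_Z4 = range (\<lambda>v. 2 *s v)"

definition psi :: "bit \<Rightarrow> 4" where
  "psi b = (if b = 0 then 0 else 1)"

definition Psi :: "bit ^ 'n \<Rightarrow> 4 ^ 'n" where
  "Psi a = (\<chi> i. psi (a $ i))"

definition pairing :: "bit ^ 'n \<Rightarrow> bit ^ 'n \<Rightarrow> 4 ^ 'n"  (\<open>\<lfloor>_,/ _\<rfloor>\<close>) where
  "\<lfloor>a, b\<rfloor> = Psi a + 2 *s Psi b"

text \<open>By \<open>ex1_represents\<close> below, a relative difference set has exactly one such \<^term>\<open>h\<close>.\<close>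

definition represents :: "(bit ^ 'n \<Rightarrow> bit ^ 'n) \<Rightarrow> (4 ^ 'n) set \<Rightarrow> bool" where
  "represents h D \<longleftrightarrow> D = {\<lfloor>d, h d\<rfloor> | d. True}"

text \<open>
  A reduced polynomial is given by its coefficients: \<^term>\<open>c S\<close> is the coefficient of the
  squarefree monomial \<open>\<Prod>i\<in>S. x\<^sub>i\<close>. Its degree is \<^term>\<open>card S\<close>, so the constant term belongs to
  \<^term>\<open>{}\<close> and the linear terms to the singletons.
\<close>

definition reduced_poly_eval :: "('n::finite set \<Rightarrow> bit) \<Rightarrow> bit ^ 'n \<Rightarrow> bit" where
  "reduced_poly_eval c x = (\<Sum>S\<in>UNIV. c S * (\<Prod>i\<in>S. x $ i))"

text \<open>The description operator is justified by \<open>ex1_reduced_poly\<close> below.\<close>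

definition reduced_poly :: "(bit ^ 'n \<Rightarrow> bit) \<Rightarrow> 'n::finite set \<Rightarrow> bit" where
  "reduced_poly f = (THE c. \<forall>x. f x = reduced_poly_eval c x)"

definition normalized :: "(bit ^ 'n \<Rightarrow> bit ^ 'n::finite) \<Rightarrow> bool" where
  "normalized h \<longleftrightarrow>
     (\<forall>i. reduced_poly (\<lambda>x. h x $ i) {} = 0 \<and> (\<forall>j. reduced_poly (\<lambda>x. h x $ i) {j} = 0))"

definition odot :: "bit ^ 'n \<Rightarrow> bit ^ 'n \<Rightarrow> bit ^ 'n"  (infixl \<open>\<odot>\<close> 70) where
  "x \<odot> y = (\<chi> i. x $ i * y $ i)"

definition star :: "(bit ^ 'n \<Rightarrow> bit ^ 'n) \<Rightarrow> bit ^ 'n \<Rightarrow> bit ^ 'n \<Rightarrow> bit ^ 'n" where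
  "star h x y = h (x + y) + h x + h y + x \<odot> y"

definition rho :: "4 ^ 'n ^ 'n \<Rightarrow> 4 ^ 'n \<Rightarrow> 4 ^ 'n" where
  "rho L v = L *v v"

text \<open>\<^const>\<open>Rep_bit0\<close> returns the representative in \<open>{0, 1, 2, 3}\<close>.\<close>

definition mod2 :: "4 \<Rightarrow> bit" where
  "mod2 a = of_int (Rep_bit0 a)"

lemma mod2_of_int: "mod2 (of_int k) = of_int k"
proof -
  have "mod2 (of_int k) = of_int (k mod 4)"
    using bit0.Rep_Abs_mod[where 'a = "num1 bit0", of k] by (simp add: mod2_def bit0.of_int_eq)
  also have "\<dots> = (of_int k :: bit)"
  proof -
    have "(of_int k :: bit) = of_int (4 * (k div 4) + k mod 4)" by simp
    also have "\<dots> = of_int 4 * of_int (k div 4) + of_int (k mod 4)"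
      by (simp only: of_int_add of_int_mult)
    finally show ?thesis by simp
  qed
  finally show ?thesis .
qed

lemma Z4_cases: "a = 0 \<or> a = 1 \<or> a = 2 \<or> a = (3::4)"
proof (cases a)
  case (of_int z)
  then have "z = 0 \<or> z = 1 \<or> z = 2 \<or> z = 3" by auto
  then show ?thesis using of_int by auto
qed

lemma psi_cases: "\<exists>!p. a = psi (fst p) + 2 * psi (snd p)"
proof -
  have inj: "p = q" if "psi (fst p) + 2 * psi (snd p) = psi (fst q) + 2 * psi (snd q)" for p q
    using that
    by (cases "fst p"; cases "snd p"; cases "fst q"; cases "snd q")
      (auto simp: psi_def prod_eq_iff)
  have "a = psi 0 + 2 * psi 0 \<or> a = psi 1 + 2 * psi 0 \<or> a = psi 0 + 2 * psi 1 \<or> a = psi 1 + 2 * psi 1"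
    using Z4_cases[of a] by (auto simp: psi_def)
  then have "\<exists>p. a = psi (fst p) + 2 * psi (snd p)"
    by (metis fst_conv snd_conv)
  with inj show ?thesis by metis
qed

lemma pairing_unique: "\<exists>!p. v = \<lfloor>fst p, snd p\<rfloor>"
proof -
  have "\<forall>i. \<exists>p. v $ i = psi (fst p) + 2 * psi (snd p)"
    using psi_cases by blast
  then obtain f where f: "\<And>i. v $ i = psi (fst (f i)) + 2 * psi (snd (f i))"
    by metis
  have *: "v = \<lfloor>\<chi> i. fst (f i), \<chi> i. snd (f i)\<rfloor>"
    by (simp add: pairing_def Psi_def vec_eq_iff f)
  have "p = q" if "\<lfloor>fst p, snd p\<rfloor> = \<lfloor>fst q, snd q\<rfloor>" for p q :: "(bit ^ 'a) \<times> (bit ^ 'a)"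
  proof -
    have "fst p $ i = fst q $ i \<and> snd p $ i = snd q $ i" for i
    proof -
      have "psi (fst p $ i) + 2 * psi (snd p $ i) = psi (fst q $ i) + 2 * psi (snd q $ i)"
        using that by (simp add: pairing_def Psi_def vec_eq_iff)
      then show ?thesis
        using psi_cases[of "psi (fst p $ i) + 2 * psi (snd p $ i)"]
        by (metis fst_conv snd_conv)
    qed
    then show ?thesis by (simp add: prod_eq_iff vec_eq_iff)
  qed
  with * show ?thesis by (metis fst_conv snd_conv)
qed

lemma UNIV_bit_eq: "(UNIV :: bit set) = {0, 1}"
  using bit.exhaust by auto

instance bit :: finite
  by standard (simp add: UNIV_bit_eq)

lemma card_bit_vec: "CARD(bit ^ 'n) = 2 ^ CARD('n::finite)"
  by (simp add: UNIV_bit_eq numeral_2_eq_2)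

lemma ex1_represents:
  fixes D :: "(4 ^ 'n::finite) set"
  assumes "relative_difference_set (2 ^ CARD('n)) (2 ^ CARD('n)) (2 ^ CARD('n)) 1 twice_Z4 D"
  shows "\<exists>!h. represents h D"
proof -
  have card: "card D = 2 ^ CARD('n)"
    and "\<forall>g\<in>twice_Z4. g \<noteq> 0 \<longrightarrow> \<not> (\<exists>x\<in>D. \<exists>y\<in>D. x - y = g)"
    using assms unfolding relative_difference_set_def by blast+
  then have no: "\<And>x y. x \<in> D \<Longrightarrow> y \<in> D \<Longrightarrow> x - y \<in> twice_Z4 \<Longrightarrow> x = y"
    by (metis right_minus_eq)
  have inj: "b = b'" if "\<lfloor>a, b\<rfloor> \<in> D" "\<lfloor>a, b'\<rfloor> \<in> D" for a b b'
  proof -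
    have "\<lfloor>a, b\<rfloor> - \<lfloor>a, b'\<rfloor> = 2 *s (Psi b - Psi b')"
      by (simp add: pairing_def vec_eq_iff algebra_simps)
    then have "\<lfloor>a, b\<rfloor> = \<lfloor>a, b'\<rfloor>"
      using no that by (metis rangeI twice_Z4_def)
    then show ?thesis
      using pairing_unique[of "\<lfloor>a, b\<rfloor>"] by (metis fst_conv snd_conv)
  qed
  obtain p where p: "\<And>v :: 4 ^ 'n. v = \<lfloor>fst (p v), snd (p v)\<rfloor>"
    using pairing_unique by metis
  have "inj_on (\<lambda>v. fst (p v)) D"
  proof (rule inj_onI)
    fix v w assume *: "v \<in> D" "w \<in> D" "fst (p v) = fst (p w)"
    have "\<lfloor>fst (p v), snd (p v)\<rfloor> \<in> D" "\<lfloor>fst (p v), snd (p w)\<rfloor> \<in> D"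
      using *(1,2) p[of v] p[of w] *(3) by simp_all
    then have "snd (p v) = snd (p w)" by (rule inj)
    then show "v = w" using * p[of v] p[of w] by simp
  qed
  then have "card ((\<lambda>v. fst (p v)) ` D) = CARD(bit ^ 'n)"
    by (simp add: card_image card card_bit_vec del: CARD_vec)
  then have "(\<lambda>v. fst (p v)) ` D = UNIV"
    by (metis card_subset_eq finite subset_UNIV)
  then have surj: "\<exists>v\<in>D. a = fst (p v)" for a by blast
  have "\<forall>a. \<exists>b. \<lfloor>a, b\<rfloor> \<in> D"
  proof
    fix a
    obtain v where "v \<in> D" "a = fst (p v)" using surj by blast
    then have "\<lfloor>a, snd (p v)\<rfloor> \<in> D" by (simp flip: p)
    then show "\<exists>b. \<lfloor>a, b\<rfloor> \<in> D" ..
  qed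
  then obtain h where h: "\<And>a. \<lfloor>a, h a\<rfloor> \<in> D" by metis
  have "represents h D"
    unfolding represents_def
  proof (intro equalityI subsetI)
    fix v assume "v \<in> D"
    then have "\<lfloor>fst (p v), snd (p v)\<rfloor> \<in> D" by (simp flip: p)
    then have "snd (p v) = h (fst (p v))" using h by (rule inj)
    then have "v = \<lfloor>fst (p v), h (fst (p v))\<rfloor>" using p[of v] by simp
    then show "v \<in> {\<lfloor>d, h d\<rfloor> | d. True}" by blast
  qed (use h in auto)
  moreover have "g = h" if "represents g D" for g
  proof
    fix a
    have "\<lfloor>a, g a\<rfloor> \<in> D" using that by (auto simp: represents_def)
    then show "g a = h a" using h by (rule inj)
  qed
  ultimately show ?thesis by blast
qed

lemma reduced_poly_eval_indicator:
  "reduced_poly_eval c (\<chi> i. if i \<in> S then 1 else 0) = (\<Sum>T\<in>Pow S. c T)"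
proof -
  have "(\<Prod>i\<in>T. if i \<in> S then 1 else (0::bit)) = (if T \<subseteq> S then 1 else 0)" for T
    by (induction T rule: infinite_finite_induct) auto
  then have "reduced_poly_eval c (\<chi> i. if i \<in> S then 1 else 0) =
      (\<Sum>T\<in>UNIV. if T \<in> Pow S then c T else 0)"
    unfolding reduced_poly_eval_def by (intro sum.cong) auto
  also have "\<dots> = (\<Sum>T\<in>Pow S. c T)"
    by (subst sum.inter_restrict[symmetric]) auto
  finally show ?thesis .
qed

lemma ex1_reduced_poly: "\<exists>!c. \<forall>x. f x = reduced_poly_eval c x"
  for f :: "bit ^ 'n::finite \<Rightarrow> bit"
proof -
  have inj: "inj (reduced_poly_eval :: ('n set \<Rightarrow> bit) \<Rightarrow> _)"
  proof (rule injI, rule ext)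
    fix c d :: "'n set \<Rightarrow> bit" and S
    assume eq: "reduced_poly_eval c = reduced_poly_eval d"
    show "c S = d S"
    proof (induction S rule: measure_induct_rule[where f = card])
      case (less S)
      have "(\<Sum>T\<in>Pow S. c T) = (\<Sum>T\<in>Pow S. d T)"
        by (simp flip: reduced_poly_eval_indicator add: eq)
      moreover have "(\<Sum>T\<in>Pow S - {S}. c T) = (\<Sum>T\<in>Pow S - {S}. d T)"
        by (rule sum.cong) (auto intro!: less psubset_card_mono)
      moreover have "(\<Sum>T\<in>Pow S. e T) = e S + (\<Sum>T\<in>Pow S - {S}. e T)" for e :: "'n set \<Rightarrow> bit"
        by (rule sum.remove) auto
      ultimately show ?case by (metis add_right_imp_eq)
    qed
  qed
  have "card (range (reduced_poly_eval :: ('n set \<Rightarrow> bit) \<Rightarrow> _)) = CARD('n set \<Rightarrow> bit)"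
    using inj by (rule card_image)
  also have "\<dots> = CARD(bit ^ 'n \<Rightarrow> bit)"
    by (simp add: card_fun card_bit_vec del: CARD_vec)
  finally have "range (reduced_poly_eval :: ('n set \<Rightarrow> bit) \<Rightarrow> _) = UNIV"
    by (metis card_subset_eq finite subset_UNIV)
  then obtain c where "f = reduced_poly_eval c" by (metis surjD)
  with inj show ?thesis by (auto simp: fun_eq_iff dest: injD)
qed

end

theory Submission
  imports Defs
begin

text \<open>
  In the coordinates \<open>\<lfloor>a, b\<rfloor>\<close> the addition of \<open>\<int>\<^sub>4\<^sup>n\<close> reads
  \<open>\<lfloor>a, b\<rfloor> + \<lfloor>c, d\<rfloor> = \<lfloor>a + c, b + d + a \<odot> c\<rfloor>\<close>. Hence a map lifting \<open>M\<close> is additive iff it has the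
  form \<open>\<lfloor>a, b\<rfloor> \<mapsto> \<lfloor>M a, g a + M b\<rfloor>\<close> where
  \<open>g (a + c) + M (a \<odot> c) = g a + g c + M a \<odot> M c\<close>, and it carries \<open>D1\<close> to \<open>D2\<close> iff
  \<open>h2 (M a) = g a + M (h1 a)\<close>. Eliminating \<open>g\<close> from these two conditions leaves exactly the
  compatibility of \<open>M\<close> with the two star products.
\<close>

lemma mod2_add: "mod2 (a + b) = mod2 a + mod2 b"
  by (cases a; cases b) (metis mod2_of_int of_int_add)

lemma mod2_mult: "mod2 (a * b) = mod2 a * mod2 b"
  by (cases a; cases b) (metis mod2_of_int of_int_mult)

lemma mod2_0 [simp]: "mod2 0 = 0"
  using mod2_of_int[of 0] by simp

lemma mod2_sum: "mod2 (\<Sum>i\<in>A. f i) = (\<Sum>i\<in>A. mod2 (f i))"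
  by (induction A rule: infinite_finite_induct) (simp_all add: mod2_add)

lemma mod2_pairing: "mod2 (\<lfloor>a, b\<rfloor> $ i) = a $ i"
proof -
  have "mod2 1 = 1" and "mod2 2 = 0"
    using mod2_of_int[of 1] mod2_of_int[of 2] by simp_all
  then show ?thesis
    by (simp add: pairing_def Psi_def psi_def mod2_add mod2_mult)
qed

lemma mod2_matrix_vector_mult:
  "mod2 ((L *v \<lfloor>a, b\<rfloor>) $ i) = (map_matrix mod2 L *v a) $ i"
  by (simp add: matrix_vector_mult_def map_matrix_def mod2_sum mod2_mult mod2_pairing)

lemma pairing_eq_iff: "\<lfloor>a, b\<rfloor> = \<lfloor>c, d\<rfloor> \<longleftrightarrow> a = c \<and> b = d"
  using pairing_unique[of "\<lfloor>a, b\<rfloor>"] by (metis fst_conv snd_conv)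

lemma pairing_exists: "\<exists>a b. v = \<lfloor>a, b\<rfloor>"
  using pairing_unique[of v] by metis

text \<open>Binary addition with carry in each coordinate: \<open>psi\<close> fails to be additive
  only at 1 + 1 = 2, so the carry into the second digit is the product of the first digits.\<close>

lemma pairing_add: "\<lfloor>a, b\<rfloor> + \<lfloor>c, d\<rfloor> = \<lfloor>a + c, b + d + a \<odot> c\<rfloor>"
proof -
  have "psi s + 2 * psi t + (psi u + 2 * psi v) = psi (s + u) + 2 * psi (t + v + s * u)" for s t u v
    by (cases s; cases t; cases u; cases v) (simp_all add: psi_def)
  then show ?thesis
    by (simp add: vec_eq_iff pairing_def Psi_def odot_def)
qed

text \<open>Shows that an additive map is determined by its values on the elements
  \<open>\<lfloor>a, 0\<rfloor>\<close>.\<close>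

lemma pairing_split: "\<lfloor>a, b\<rfloor> = \<lfloor>a, 0\<rfloor> + (\<lfloor>b, 0\<rfloor> + \<lfloor>b, 0\<rfloor>)"
  by (simp add: vec_eq_iff pairing_def Psi_def psi_def)

lemma bit_vec_add_self [simp]: "x + x = 0" for x :: "bit ^ 'n"
  by (simp add: vec_eq_iff)

lemma bit_vec_add_left_self [simp]: "x + (x + y) = y" for x y :: "bit ^ 'n"
  by (simp flip: add.assoc)

lemma odot_0_right [simp]: "x \<odot> 0 = 0"
  by (simp add: odot_def vec_eq_iff)

lemma odot_self [simp]: "x \<odot> x = x"
  by (simp add: odot_def vec_eq_iff)

lemma two_smult: "2 *s v = v + v" and three_smult: "3 *s v = v + v + v"
  for v :: "4 ^ 'n"
  by (simp_all add: vec_eq_iff)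

text \<open>Scalars in \<open>4\<close> act by repeated addition, so additivity already gives
  linearity; the columns of \<open>L\<close> are the images of the unit vectors.\<close>

lemma additive_imp_matrix:
  fixes f :: "4 ^ 'n::finite \<Rightarrow> 4 ^ 'm"
  assumes add: "\<And>v w. f (v + w) = f v + f w"
  obtains L where "\<And>v. f v = L *v v"
proof
  fix v
  have zero: "f 0 = 0"
    using add[of 0 0] by simp
  have scale: "f (c *s w) = c *s f w" for c w
    using Z4_cases[of c]
    by (elim disjE)
      (simp_all only: zero add two_smult three_smult vector_smult_lzero vector_smult_lid)
  have sum: "f (\<Sum>i\<in>A. g i) = (\<Sum>i\<in>A. f (g i))" for g and A :: "'n set"
    by (induction A rule: infinite_finite_induct) (simp_all add: add zero)
  have "f v = f (\<Sum>i\<in>UNIV. v $ i *s axis i 1)"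
    by (simp add: basis_expansion)
  also have "\<dots> = (\<Sum>i\<in>UNIV. v $ i *s f (axis i 1))"
    by (simp add: sum scale)
  also have "\<dots> = (\<chi> i j. f (axis j 1) $ i) *v v"
    by (simp add: vec_eq_iff matrix_vector_mult_def mult.commute)
  finally show "f v = (\<chi> i j. f (axis j 1) $ i) *v v" .
qed

lemma represents_iff_range: "represents h D \<longleftrightarrow> D = range (\<lambda>d. \<lfloor>d, h d\<rfloor>)"
  by (simp add: represents_def full_SetCompr_eq)

text \<open>As \<open>M\<close> is bijective, both sets contain exactly one element with first digit
  \<open>M a\<close> for each \<open>a\<close>, so only the second digits need comparing.\<close>

lemma image_representation_iff:
  assumes "represents h1 D1" and "represents h2 D2" and "bij M"
    and f: "\<And>a b. f \<lfloor>a, b\<rfloor> = \<lfloor>M a, g a + M b\<rfloor>"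
  shows "D2 = f ` D1 \<longleftrightarrow> (\<forall>a. h2 (M a) = g a + M (h1 a))"
proof -
  have D1: "f ` D1 = range (\<lambda>a. \<lfloor>M a, g a + M (h1 a)\<rfloor>)"
    using assms(1) by (simp add: represents_iff_range image_image f)
  have "D2 = range (\<lambda>d. \<lfloor>d, h2 d\<rfloor>)"
    using assms(2) by (simp add: represents_iff_range)
  also have "\<dots> = range (\<lambda>a. \<lfloor>M a, h2 (M a)\<rfloor>)"
    unfolding image_image[of "\<lambda>d. \<lfloor>d, h2 d\<rfloor>" M UNIV, symmetric] bij_is_surj[OF assms(3)] ..
  finally have D2: "D2 = range (\<lambda>a. \<lfloor>M a, h2 (M a)\<rfloor>)" .
  show ?thesis
  proof
    assume "D2 = f ` D1"
    show "\<forall>a. h2 (M a) = g a + M (h1 a)"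
    proof
      fix a
      have "\<lfloor>M a, h2 (M a)\<rfloor> \<in> f ` D1"
        using D2 \<open>D2 = f ` D1\<close> by blast
      then obtain c where "M a = M c" "h2 (M a) = g c + M (h1 c)"
        unfolding D1 by (auto simp: pairing_eq_iff)
      then show "h2 (M a) = g a + M (h1 a)"
        using bij_is_inj[OF assms(3)] by (metis injD)
    qed
  qed (simp add: D1 D2)
qed

text \<open>In characteristic 2 an equation holds iff its two sides sum to 0. Both equations have
  the same such sum, because all terms in \<open>h1\<close> occur twice and cancel.\<close>

lemma star_compatible_iff:
  assumes M: "\<And>x y. M (x + y) = M x + M y"
    and h2: "\<And>a. h2 (M a) = g a + M (h1 a)"
  shows "star h2 (M x) (M y) = M (star h1 x y) \<longleftrightarrow>
    g (x + y) + M (x \<odot> y) = g x + g y + M x \<odot> M y"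
proof -
  have eq_iff: "u = v \<longleftrightarrow> u + v = 0" for u v :: "bit ^ 'b"
    by (metis add_right_cancel bit_vec_add_self)
  have "star h2 (M x) (M y) + M (star h1 x y) =
      (g (x + y) + M (x \<odot> y)) + (g x + g y + M x \<odot> M y)"
    by (simp add: star_def M h2 ac_simps flip: M)
  then show ?thesis
    using eq_iff by metis
qed

theorem theorem2p3:
  fixes D1 D2 :: "(4 ^ 'n::finite) set"
    and h1 h2 M :: "bit ^ 'n \<Rightarrow> bit ^ 'n"
  assumes "relative_difference_set (2 ^ CARD('n)) (2 ^ CARD('n)) (2 ^ CARD('n)) 1 twice_Z4 D1"
    and "relative_difference_set (2 ^ CARD('n)) (2 ^ CARD('n)) (2 ^ CARD('n)) 1 twice_Z4 D2"
    and "represents h1 D1" and "represents h2 D2"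
    and "normalized h1" and "normalized h2"
    and "Vector_Spaces.linear (*s) (*s) M" and "bij M"
  shows "(\<exists>L :: 4 ^ 'n ^ 'n. (\<forall>x. map_matrix mod2 L *v x = M x) \<and> D2 = rho L ` D1) \<longleftrightarrow>
         (\<forall>x y. star h2 (M x) (M y) = M (star h1 x y))"
proof
  have M: "M (x + y) = M x + M y" for x y
    using assms(7) by (rule vec.linear_add)
  have M0: "M 0 = 0"
    using M[of 0 0] by simp
  {
    assume "\<exists>L :: 4 ^ 'n ^ 'n. (\<forall>x. map_matrix mod2 L *v x = M x) \<and> D2 = rho L ` D1"
    then obtain L :: "4 ^ 'n ^ 'n" where L: "\<And>x. map_matrix mod2 L *v x = M x"
      and D2: "D2 = rho L ` D1"
      by blast
    have "\<exists>c. L *v \<lfloor>a, 0\<rfloor> = \<lfloor>M a, c\<rfloor>" for a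
    proof -
      obtain b c where bc: "L *v \<lfloor>a, 0\<rfloor> = \<lfloor>b, c\<rfloor>"
        using pairing_exists by blast
      \<comment> \<open>The first digit is the residue modulo 2, on which \<open>L\<close> acts as
        \<open>M\<close>.\<close>
      then have "b = M a"
        using mod2_matrix_vector_mult[of L a 0] by (simp add: vec_eq_iff mod2_pairing L)
      with bc show ?thesis by blast
    qed
    then obtain g where g: "\<And>a. L *v \<lfloor>a, 0\<rfloor> = \<lfloor>M a, g a\<rfloor>"
      by metis
    have rho: "rho L \<lfloor>a, b\<rfloor> = \<lfloor>M a, g a + M b\<rfloor>" for a b
    proof -
      \<comment> \<open>Doubling \<open>\<lfloor>M b, g b\<rfloor>\<close> kills both digits and
        leaves the carry \<open>M b \<odot> M b = M b\<close> in the second one.\<close>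
      have "rho L \<lfloor>a, b\<rfloor> = \<lfloor>M a, g a\<rfloor> + (\<lfloor>M b, g b\<rfloor> + \<lfloor>M b, g b\<rfloor>)"
        by (subst pairing_split) (simp only: rho_def matrix_vector_right_distrib g)
      then show ?thesis
        by (simp add: pairing_add)
    qed
    have h2: "h2 (M a) = g a + M (h1 a)" for a
      using image_representation_iff[OF assms(3,4,8) rho] D2 by blast
    have "g (x + y) + M (x \<odot> y) = g x + g y + M x \<odot> M y" for x y
    proof -
      \<comment> \<open>The argument on the left is
        \<open>\<lfloor>x + y, x \<odot> y\<rfloor>\<close>; comparing second digits gives the
        condition on \<open>g\<close>.\<close>
      have "rho L (\<lfloor>x, 0\<rfloor> + \<lfloor>y, 0\<rfloor>) = rho L \<lfloor>x, 0\<rfloor> + rho L \<lfloor>y, 0\<rfloor>"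
        by (simp add: rho_def matrix_vector_right_distrib)
      then show ?thesis
        by (simp add: pairing_add rho pairing_eq_iff M0)
    qed
    then show "\<forall>x y. star h2 (M x) (M y) = M (star h1 x y)"
      using star_compatible_iff[of M h2 g h1, OF M h2] by blast
  }
  {
    assume star: "\<forall>x y. star h2 (M x) (M y) = M (star h1 x y)"
    \<comment> \<open>The only candidate: the equation carrying \<open>D1\<close> to
      \<open>D2\<close>, solved for \<open>g\<close>.\<close>
    define g where "g a = h2 (M a) + M (h1 a)" for a
    have h2: "h2 (M a) = g a + M (h1 a)" for a
      by (simp add: g_def add.assoc)
    have g: "g (x + y) + M (x \<odot> y) = g x + g y + M x \<odot> M y" for x y
      using star_compatible_iff[of M h2 g h1, OF M h2] star by blast
    obtain p q where pq: "\<And>v :: 4 ^ 'n. v = \<lfloor>p v, q v\<rfloor>"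
      using pairing_exists by metis
    define f where "f v = \<lfloor>M (p v), g (p v) + M (q v)\<rfloor>" for v
    have f: "f \<lfloor>a, b\<rfloor> = \<lfloor>M a, g a + M b\<rfloor>" for a b
      using pq[of "\<lfloor>a, b\<rfloor>"] by (simp add: f_def pairing_eq_iff)
    have "f (v + w) = f v + f w" for v w
    proof -
      obtain a b c d where "v = \<lfloor>a, b\<rfloor>" "w = \<lfloor>c, d\<rfloor>"
        using pairing_exists by metis
      then show ?thesis
        using g[of a c] by (simp add: pairing_add f M pairing_eq_iff ac_simps)
    qed
    then obtain L where L: "\<And>v. f v = L *v v"
      using additive_imp_matrix by blast
    \<comment> \<open>Read off from the first digit of
      \<open>f \<lfloor>x, 0\<rfloor>\<close>.\<close>
    have "map_matrix mod2 L *v x = M x" for x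
      using mod2_matrix_vector_mult[of L x 0]
      by (simp add: vec_eq_iff mod2_pairing f flip: L)
    moreover have "D2 = rho L ` D1"
      using image_representation_iff[OF assms(3,4,8) f] h2 by (simp add: rho_def L)
    ultimately show "\<exists>L :: 4 ^ 'n ^ 'n. (\<forall>x. map_matrix mod2 L *v x = M x) \<and> D2 = rho L ` D1"
      by blast
  }
qed

end
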